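(* Let $x_1,x_2,\dots$ be independent identically distributed random variables in $[0,1]$ with common probability density $f$ such that $f(x)/(c x^{\beta})\to1$ as $x\to0^+$, where $c>0$ and $-1<\beta<0$. Let $H_n$ be the harmonic mean of $x_1,\dots,x_n$. Then there exists a constant $\mathfrak C_2$ such that $$\lim_{n\to\infty}\mathbf E\left(\frac{H_n}{n^{1-1/(1+\beta)}}\right)=\mathfrak C_2.$$
   Context: The harmonic mean is $H_n=1/X_n$ with $X_n=\frac1n\sum_{i=1}^n\frac1{x_i}$. *)

theory Defs
  imports "HOL-Probability.Probability"
begin

definition reciprocal_mean :: "(nat \<Rightarrow> real) \<Rightarrow> nat \<Rightarrow> real" where
  "reciprocal_mean x n = (1 / real n) * (\<Sum>i=1..n. 1 / x i)"

(* If some x i is 0, then 1 / x i is 0 by HOL convention; for random variables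
   with a density this only happens on a null set. *)
definition harmonic_mean :: "(nat \<Rightarrow> real) \<Rightarrow> nat \<Rightarrow> real" where
  "harmonic_mean x n = 1 / reciprocal_mean x n"

end

theory Submission
  imports Defs "HOL-Real_Asymp.Real_Asymp"
begin

text \<open>
  Write \<open>a = 1 + \<beta>\<close>, \<open>S\<^sub>n = \<Sum>i=1..n. 1 / x\<^sub>i\<close> and let \<open>\<phi>(s)\<close> be the Laplace transform of \<open>1 / x\<^sub>1\<close>.
  The rescaled harmonic mean is \<open>n powr (1/a) / S\<^sub>n\<close>. Since \<open>1 / S\<close> is the integral of \<open>exp (- t S)\<close>
  over \<open>t \<ge> 0\<close>, Tonelli and independence turn its expectation into the integral of
  \<open>\<phi>(t / n powr (1/a)) ^ n\<close> over \<open>t \<ge> 0\<close>. The behaviour of the density at 0 gives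
  \<open>1 - \<phi>(s) \<sim> K * s powr a\<close> as \<open>s \<rightarrow> 0\<close> with \<open>K > 0\<close>, so the integrand tends to \<open>exp (- K * t powr a)\<close>.
  Together with \<open>\<phi>(s) \<le> exp (- s)\<close>, which holds because \<open>1 / x\<^sub>1 \<ge> 1\<close>, it also gives
  \<open>\<phi>(s) \<le> exp (- k * s powr a)\<close> for all \<open>s \<ge> 0\<close> and some \<open>k > 0\<close>; hence \<open>exp (- k * t powr a)\<close>
  dominates the integrand for every \<open>n\<close>.
\<close>

section \<open>The Laplace transform of the reciprocal near 0\<close>

text \<open>Near 0 the factor \<open>1 - exp (- 1 / u)\<close> is at most 1 and
  \<open>u powr \<beta>\<close> is integrable because \<beta> > -1. Near infinity the factor is at
  most \<open>1 / u\<close>, which leaves \<open>u powr (\<beta> - 1)\<close>, integrable because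
  \<beta> < 0.\<close>

lemma integrable_powr_mult_exp_deficit:
  fixes \<beta> :: real
  assumes "-1 < \<beta>" "\<beta> < 0"
  shows "integrable lborel (\<lambda>u. indicator {0<..} u * (u powr \<beta> * (1 - exp (- 1 / u))))"
proof -
  have 1: "integrable lborel (\<lambda>u. indicator {0<..1} u * u powr \<beta>)"
  proof -
    have "(\<lambda>u. u powr \<beta>) absolutely_integrable_on {0<..1}"
      using assms by (intro nonnegative_absolutely_integrable_1 integrable_on_powr_from_0') auto
    then show ?thesis
      by (simp add: set_integrable_def integrable_completion)
  qed
  have 2: "integrable lborel (\<lambda>u. indicator {1..} u * u powr (\<beta> - 1))"
  proof -
    have "(\<integral>\<^sup>+u. ennreal (u powr (\<beta> - 1)) * indicator {1..} u \<partial>lborel) = ennreal (0 - 1 powr \<beta> / \<beta>)"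
    proof (rule nn_integral_FTC_atLeast)
      show "((\<lambda>x. x powr \<beta> / \<beta>) \<longlongrightarrow> 0) at_top"
        using assms by real_asymp
    qed (use assms in \<open>auto intro!: derivative_eq_intros\<close>)
    then show ?thesis
      by (intro integrableI_bounded) (auto simp: abs_mult ennreal_mult' ennreal_indicator mult.commute)
  qed
  show ?thesis
  proof (rule Bochner_Integration.integrable_bound[OF Bochner_Integration.integrable_add[OF 1 2]])
    show "AE u in lborel. norm (indicator {0<..} u * (u powr \<beta> * (1 - exp (- 1 / u))))
        \<le> norm (indicator {0<..1} u * u powr \<beta> + indicator {1..} u * u powr (\<beta> - 1))"
    proof (rule AE_I2)
      fix u :: real
      consider "u \<le> 0" | "0 < u" "u \<le> 1" | "1 < u" by linarith
      then show "norm (indicator {0<..} u * (u powr \<beta> * (1 - exp (- 1 / u))))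
        \<le> norm (indicator {0<..1} u * u powr \<beta> + indicator {1..} u * u powr (\<beta> - 1))"
      proof cases
        case 2
        have "u powr \<beta> * (1 - exp (- 1 / u)) \<le> u powr \<beta> * 1"
          by (intro mult_left_mono) auto
        also have "\<dots> \<le> u powr \<beta> + indicator {1..} u * u powr (\<beta> - 1)"
          by auto
        finally show ?thesis using 2 by (auto simp: abs_mult)
      next
        case 3
        have "1 - exp (- 1 / u) \<le> 1 / u"
          using exp_ge_add_one_self[of "- 1 / u"] by simp
        then have "u powr \<beta> * (1 - exp (- 1 / u)) \<le> u powr \<beta> * (1 / u)"
          by (intro mult_left_mono) auto
        then show ?thesis using 3 by (auto simp: abs_mult powr_diff)
      qed auto
    qed
  qed measurable
qed

text \<open>Only values of \<open>x\<close> of order \<open>s\<close> matter. Rescaling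
  \<open>x = s * u\<close> extracts the factor \<open>s powr (1 + \<beta>)\<close> and leaves an
  integrand converging to the power-law kernel, while the part away from 0 is \<open>O(s)\<close>,
  of smaller order because \<beta> < 0.\<close>

lemma laplace_deficit_asymp:
  fixes f :: "real \<Rightarrow> real" and c \<beta> :: real
  assumes int: "integrable lborel f" and nn: "\<And>x. f x \<ge> 0"
    and supp: "AE x in lborel. x \<le> 0 \<longrightarrow> f x = 0"
    and c: "c > 0" and \<beta>: "-1 < \<beta>" "\<beta> < 0"
    and lim: "((\<lambda>x. f x / (c * x powr \<beta>)) \<longlongrightarrow> 1) (at_right 0)"
  shows "((\<lambda>s. (\<integral>x. f x * (1 - exp (- s / x)) \<partial>lborel) / s powr (1 + \<beta>)) \<longlongrightarrow>
     (\<integral>u. indicator {0<..} u * (c * (u powr \<beta> * (1 - exp (- 1 / u)))) \<partial>lborel)) (at_right 0)"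
  \<comment> \<open>Dominated convergence is applied along an arbitrary sequence \<open>S\<close>
    decreasing or not to 0 through positive values.\<close>
  unfolding tendsto_at_iff_sequentially
proof (intro allI impI)
  fix S :: "nat \<Rightarrow> real"
  assume "\<forall>i. S i \<in> {0<..} - {0}" and S0: "S \<longlonglongrightarrow> 0"
  then have Spos: "S i > 0" for i by auto
  have [measurable]: "f \<in> borel_measurable borel"
    using int by (simp add: borel_measurable_integrable)
  \<comment> \<open>Any constant above the limit 1 would serve; it gives a power-law upper bound for
    \<open>f\<close> on (0, \<delta>), the source of the dominating function.\<close>
  have "eventually (\<lambda>x. f x / (c * x powr \<beta>) < 2) (at_right 0)"
    using lim by (rule order_tendstoD) simp
  then obtain \<delta> where \<delta>: "\<delta> > 0" and "\<And>x. 0 < x \<Longrightarrow> x < \<delta> \<Longrightarrow> f x / (c * x powr \<beta>) < 2"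
    by (auto simp: eventually_at_right[OF zero_less_one])
  then have f_le: "f x \<le> 2 * c * x powr \<beta>" if "0 < x" "x < \<delta>" for x
    using that c by (fastforce simp: field_simps)
  \<comment> \<open>Cut at \<delta>: \<open>A\<close> carries the singularity at 0, \<open>B\<close>
    is the negligible rest. The half-line \<open>x \<le> 0\<close> contributes nothing by
    \<open>supp\<close>.\<close>
  define A where "A = (\<lambda>i x. indicator {0<..<\<delta>} x * (f x * (1 - exp (- S i / x))))"
  define B where "B = (\<lambda>i x. indicator {\<delta>..} x * (f x * (1 - exp (- S i / x))))"
  have A_int: "integrable lborel (A i)" for i
  proof (rule Bochner_Integration.integrable_bound[OF int])
    show "AE x in lborel. norm (A i x) \<le> norm (f x)"
      using Spos[of i] nn unfolding A_def
      by (intro AE_I2) (auto simp: abs_mult indicator_def intro!: mult_left_le)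
  qed (simp add: A_def)
  have B_le: "0 \<le> B i x" "B i x \<le> S i / \<delta> * f x" for i x
  proof -
    have "1 - exp (- S i / x) \<le> S i / \<delta>" "0 \<le> 1 - exp (- S i / x)" if "\<delta> \<le> x"
    proof -
      have "1 - exp (- S i / x) \<le> S i / x"
        using exp_ge_add_one_self[of "- S i / x"] by simp
      also have "\<dots> \<le> S i / \<delta>"
        using that \<delta> Spos[of i] by (intro divide_left_mono) auto
      finally show "1 - exp (- S i / x) \<le> S i / \<delta>" .
      show "0 \<le> 1 - exp (- S i / x)"
        using that \<delta> Spos[of i] by simp
    qed
    then have "\<delta> \<le> x \<Longrightarrow> f x * (1 - exp (- S i / x)) \<le> f x * (S i / \<delta>)"
      "\<delta> \<le> x \<Longrightarrow> 0 \<le> f x * (1 - exp (- S i / x))"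
      using nn[of x] by (intro mult_left_mono mult_nonneg_nonneg; simp)+
    then show "0 \<le> B i x" "B i x \<le> S i / \<delta> * f x"
      using nn[of x] \<delta> Spos[of i] by (auto simp: B_def indicator_def mult.commute[of "f x"])
  qed
  have B_int: "integrable lborel (B i)" for i
  proof (rule Bochner_Integration.integrable_bound)
    show "integrable lborel (\<lambda>x. S i / \<delta> * f x)" using int by simp
    show "AE x in lborel. norm (B i x) \<le> norm (S i / \<delta> * f x)"
      using B_le[of i] by (intro AE_I2) (smt (verit) real_norm_def)
  qed (simp add: B_def)
  have split: "(\<integral>x. f x * (1 - exp (- S i / x)) \<partial>lborel) = (\<integral>x. A i x \<partial>lborel) + (\<integral>x. B i x \<partial>lborel)" for i
  proof -
    have "(\<integral>x. f x * (1 - exp (- S i / x)) \<partial>lborel) = (\<integral>x. A i x + B i x \<partial>lborel)"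
    proof (rule integral_cong_AE)
      show "AE x in lborel. f x * (1 - exp (- S i / x)) = A i x + B i x"
        using supp by eventually_elim (use \<delta> in \<open>auto simp: A_def B_def indicator_def\<close>)
    qed (simp_all add: A_def B_def)
    then show ?thesis using A_int B_int by simp
  qed
  \<comment> \<open>The integral of \<open>B i\<close> is at most a constant times
    \<open>S i\<close>, so the quotient is at most a constant times
    \<open>S i powr (- \<beta>)\<close>, with a positive exponent.\<close>
  have B_lim: "(\<lambda>i. (\<integral>x. B i x \<partial>lborel) / S i powr (1 + \<beta>)) \<longlonglongrightarrow> 0"
  proof (rule tendsto_sandwich[OF _ _ tendsto_const])
    show "\<forall>\<^sub>F i in sequentially. 0 \<le> (\<integral>x. B i x \<partial>lborel) / S i powr (1 + \<beta>)"
      using B_le by (auto intro!: divide_nonneg_nonneg Bochner_Integration.integral_nonneg)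
    have "(\<integral>x. B i x \<partial>lborel) / S i powr (1 + \<beta>) \<le> S i powr (- \<beta>) * ((\<integral>x. f x \<partial>lborel) / \<delta>)" for i
    proof -
      have "(\<integral>x. B i x \<partial>lborel) \<le> (\<integral>x. S i / \<delta> * f x \<partial>lborel)"
        using B_le int B_int by (intro integral_mono) auto
      also have "\<dots> = S i / \<delta> * (\<integral>x. f x \<partial>lborel)" by simp
      finally have "(\<integral>x. B i x \<partial>lborel) / S i powr (1 + \<beta>) \<le> S i / \<delta> * (\<integral>x. f x \<partial>lborel) / S i powr (1 + \<beta>)"
        by (intro divide_right_mono) auto
      also have "\<dots> = S i powr (- \<beta>) * ((\<integral>x. f x \<partial>lborel) / \<delta>)"
        using Spos[of i] by (simp add: powr_add powr_minus field_simps)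
      finally show ?thesis .
    qed
    then show "\<forall>\<^sub>F i in sequentially. (\<integral>x. B i x \<partial>lborel) / S i powr (1 + \<beta>)
        \<le> S i powr (- \<beta>) * ((\<integral>x. f x \<partial>lborel) / \<delta>)" by simp
    have "(\<lambda>i. S i powr (- \<beta>)) \<longlonglongrightarrow> 0"
      using \<beta> Spos by (intro tendsto_zero_powrI[OF S0 tendsto_const]) (auto simp: less_imp_le)
    then show "(\<lambda>i. S i powr (- \<beta>) * ((\<integral>x. f x \<partial>lborel) / \<delta>)) \<longlonglongrightarrow> 0"
      by (rule tendsto_mult_left_zero)
  qed
  \<comment> \<open>The substitution \<open>x = S i * u\<close> turns the main part into an integral over a fixed kernel.\<close>
  define G where "G = (\<lambda>i u. A i (S i * u) / S i powr \<beta>)"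
  \<comment> \<open>The Jacobian cancels one power of \<open>S i\<close>; the remaining
    \<open>S i powr \<beta>\<close> sits inside \<open>G\<close>.\<close>
  have A_eq: "(\<integral>x. A i x \<partial>lborel) / S i powr (1 + \<beta>) = (\<integral>u. G i u \<partial>lborel)" for i
    using lborel_integral_real_affine[of "S i" "A i" 0] Spos[of i]
    by (simp add: G_def powr_add field_simps)
  have "(\<lambda>i. \<integral>u. G i u \<partial>lborel) \<longlonglongrightarrow>
      (\<integral>u. indicator {0<..} u * (c * (u powr \<beta> * (1 - exp (- 1 / u)))) \<partial>lborel)"
  proof (rule integral_dominated_convergence)
    show "integrable lborel (\<lambda>u. 2 * c * (indicator {0<..} u * (u powr \<beta> * (1 - exp (- 1 / u)))))"
      using integrable_powr_mult_exp_deficit[OF \<beta>] by (intro integrable_mult_right) auto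
    show "AE u in lborel. norm (G i u)
        \<le> 2 * c * (indicator {0<..} u * (u powr \<beta> * (1 - exp (- 1 / u))))" for i
    proof (rule AE_I2)
      fix u :: real
      show "norm (G i u) \<le> 2 * c * (indicator {0<..} u * (u powr \<beta> * (1 - exp (- 1 / u))))"
      proof (cases "0 < u \<and> S i * u < \<delta>")
        case True
        then have pos: "0 < S i * u" using Spos[of i] by simp
        have "norm (G i u) = f (S i * u) / S i powr \<beta> * (1 - exp (- 1 / u))"
          using True pos nn[of "S i * u"] Spos[of i] by (simp add: G_def A_def abs_mult)
        also have "\<dots> \<le> 2 * c * (S i * u) powr \<beta> / S i powr \<beta> * (1 - exp (- 1 / u))"
          using True pos f_le[of "S i * u"] by (intro mult_right_mono divide_right_mono) auto
        also have "\<dots> = 2 * c * (u powr \<beta> * (1 - exp (- 1 / u)))"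
          using True Spos[of i] by (simp add: powr_mult field_simps)
        finally show ?thesis using True by simp
      next
        case False
        then have "G i u = 0"
          using Spos[of i] by (auto simp: G_def A_def zero_less_mult_iff)
        then show ?thesis using c by (simp add: indicator_def)
      qed
    qed
    show "AE u in lborel. (\<lambda>i. G i u) \<longlonglongrightarrow> indicator {0<..} u * (c * (u powr \<beta> * (1 - exp (- 1 / u))))"
    proof (rule AE_I2)
      fix u :: real
      show "(\<lambda>i. G i u) \<longlonglongrightarrow> indicator {0<..} u * (c * (u powr \<beta> * (1 - exp (- 1 / u))))"
      proof (cases "0 < u")
        case True
        have Su: "(\<lambda>i. S i * u) \<longlonglongrightarrow> 0" using tendsto_mult_left_zero[OF S0] .
        moreover have "\<forall>\<^sub>F i in sequentially. S i * u > 0"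
          using True Spos by simp
        ultimately have "filterlim (\<lambda>i. S i * u) (at_right 0) sequentially"
          by (intro tendsto_imp_filterlim_at_right)
        from filterlim_compose[OF lim this]
        have "(\<lambda>i. f (S i * u) / (c * (S i * u) powr \<beta>) * (c * (u powr \<beta> * (1 - exp (- 1 / u)))))
            \<longlonglongrightarrow> 1 * (c * (u powr \<beta> * (1 - exp (- 1 / u))))"
          by (intro tendsto_mult tendsto_const)
        \<comment> \<open>For fixed \<open>u\<close> the point \<open>S i * u\<close> eventually
          lies below \<delta>, so the cutoff in \<open>A\<close> equals 1 and the two expressions
          agree exactly.\<close>
        moreover have "\<forall>\<^sub>F i in sequentially.
            f (S i * u) / (c * (S i * u) powr \<beta>) * (c * (u powr \<beta> * (1 - exp (- 1 / u)))) = G i u"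
        proof -
          have "\<forall>\<^sub>F i in sequentially. S i * u < \<delta>"
            using Su \<delta> by (rule order_tendstoD)
          then show ?thesis
          proof eventually_elim
            case (elim i)
            then show ?case
              using Spos[of i] True c by (simp add: G_def A_def powr_mult field_simps)
          qed
        qed
        ultimately show ?thesis
          using True by (auto elim: Lim_transform_eventually)
      next
        case False
        then have "G i u = 0" for i
          using Spos[of i] by (auto simp: G_def A_def zero_less_mult_iff)
        then show ?thesis using False by simp
      qed
    qed
  qed (simp_all add: G_def A_def)
  from tendsto_add[OF this B_lim]
  show "((\<lambda>s. (\<integral>x. f x * (1 - exp (- s / x)) \<partial>lborel) / s powr (1 + \<beta>)) \<circ> S) \<longlonglongrightarrow>
     (\<integral>u. indicator {0<..} u * (c * (u powr \<beta> * (1 - exp (- 1 / u)))) \<partial>lborel)"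
    by (simp only: o_def split add_divide_distrib A_eq add_0_right)
qed

text \<open>The integrand is nonnegative and strictly positive on (0, 1), a set of positive measure.
  Positivity of this constant is what later yields a decaying dominating function.\<close>

lemma integral_exp_deficit_pos:
  fixes c \<beta> :: real
  assumes "c > 0" "-1 < \<beta>" "\<beta> < 0"
  shows "0 < (\<integral>u. indicator {0<..} u * (c * (u powr \<beta> * (1 - exp (- 1 / u)))) \<partial>lborel)"
    (is "0 < (\<integral>u. ?g u \<partial>lborel)")
proof -
  have int: "integrable lborel ?g"
    using integrable_mult_right[of c lborel, OF integrable_powr_mult_exp_deficit[OF assms(2,3)]]
    by (simp add: mult.left_commute)
  have nn: "0 \<le> ?g u" for u
    using assms by (auto simp: indicator_def)
  have "(\<integral>u. ?g u \<partial>lborel) \<noteq> 0"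
  proof
    assume "(\<integral>u. ?g u \<partial>lborel) = 0"
    then have "AE u in lborel. ?g u = 0"
      using integral_nonneg_eq_0_iff_AE[OF int] nn by simp
    then have "AE u in lborel. u \<notin> {0<..<1::real}"
      by eventually_elim (use assms in auto)
    then have "emeasure lborel {0<..<1::real} = 0"
      by (subst (asm) AE_iff_measurable[of "{0<..<1}"]) auto
    then show False by simp
  qed
  with nn show ?thesis
    by (simp add: order_less_le Bochner_Integration.integral_nonneg)
qed

section \<open>Stretched exponentials and limits of n-th powers\<close>

lemma integrable_exp_neg_powr:
  fixes k a :: real
  assumes "k > 0" "a > 0"
  shows "integrable lborel (\<lambda>t. indicator {0..} t * exp (- k * t powr a))"
proof -
  have "((\<lambda>t. (1 + t\<^sup>2) * exp (- k * t powr a)) \<longlongrightarrow> 0) at_top"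
    using assms by real_asymp
  then have "\<forall>\<^sub>F t in at_top. (1 + t\<^sup>2) * exp (- k * t powr a) < 1"
    by (rule order_tendstoD) simp
  then obtain T where T: "\<And>t. t \<ge> T \<Longrightarrow> (1 + t\<^sup>2) * exp (- k * t powr a) < 1"
    by (auto simp: eventually_at_top_linorder)
  \<comment> \<open>The constant covers both ranges: beyond \<open>T\<close> the product with 1 +
    t^2 is below 1, and before \<open>T\<close> the exponential is at most 1 while t^2 is at most
    T^2.\<close>
  have bound: "exp (- k * t powr a) \<le> (1 + T\<^sup>2) * inverse (1 + t\<^sup>2)" if "t \<ge> 0" for t
  proof (cases "t \<ge> T")
    case True
    have "(1 + t\<^sup>2) * exp (- k * t powr a) \<le> 1 + T\<^sup>2"
      using T[OF True] by (smt (verit) zero_le_power2)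
    then show ?thesis
      by (simp add: field_simps add_pos_nonneg)
  next
    case False
    have "(1 + t\<^sup>2) * exp (- k * t powr a) \<le> (1 + t\<^sup>2) * 1"
      using assms by (intro mult_left_mono) auto
    also have "\<dots> \<le> 1 + T\<^sup>2"
      using False that by (simp add: power_mono)
    finally show ?thesis
      by (simp add: field_simps add_pos_nonneg)
  qed
  have "integrable lborel (\<lambda>t::real. inverse (1 + t\<^sup>2))"
    using integrable_inverse_1_plus_square by (simp add: set_integrable_def)
  then have "integrable lborel (\<lambda>t. (1 + T\<^sup>2) * inverse (1 + t\<^sup>2))"
    by (rule integrable_mult_right)
  then show ?thesis
  proof (rule Bochner_Integration.integrable_bound)
    show "AE t in lborel. norm (indicator {0..} t * exp (- k * t powr a))
        \<le> norm ((1 + T\<^sup>2) * inverse (1 + t\<^sup>2))"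
      using bound by (intro AE_I2) (auto simp: indicator_def abs_mult)
  qed measurable
qed

text \<open>Compare \<open>p n\<close> with \<open>exp (- y / real n)\<close>, whose n-th power is
  \<open>exp (- y)\<close> for n > 0. For numbers of modulus at most 1, n-th powers differ by at
  most n times the difference of the bases, and here that bound tends to 0.\<close>

lemma power_tendsto_exp_neg:
  fixes p :: "nat \<Rightarrow> real" and y :: real
  assumes "\<And>n. 0 \<le> p n" "\<And>n. p n \<le> 1" "y \<ge> 0"
    and lim: "(\<lambda>n. real n * (1 - p n)) \<longlonglongrightarrow> y"
  shows "(\<lambda>n. p n ^ n) \<longlonglongrightarrow> exp (- y)"
proof -
  have "(\<lambda>n. real n * (1 - exp (- y / real n))) \<longlonglongrightarrow> y"
    by real_asymp
  from tendsto_diff[OF this lim] have *: "(\<lambda>n. real n * (p n - exp (- y / real n))) \<longlonglongrightarrow> 0"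
    by (simp add: algebra_simps)
  have **: "(\<lambda>n. real n * norm (p n - exp (- y / real n))) \<longlonglongrightarrow> 0"
    using tendsto_norm_zero[OF *] by (simp add: abs_mult)
  have "(\<lambda>n. p n ^ n - exp (- y / real n) ^ n) \<longlonglongrightarrow> 0"
  proof (rule Lim_null_comparison[OF _ **])
    show "\<forall>\<^sub>F n in sequentially. norm (p n ^ n - exp (- y / real n) ^ n)
        \<le> real n * norm (p n - exp (- y / real n))"
      using assms by (intro always_eventually allI norm_power_diff) auto
  qed
  moreover have "\<forall>\<^sub>F n in sequentially. exp (- y / real n) ^ n = exp (- y)"
    using eventually_gt_at_top[of 0]
    by eventually_elim (simp flip: exp_of_nat_mult)
  ultimately have "(\<lambda>n. p n ^ n - exp (- y)) \<longlonglongrightarrow> 0"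
    by (rule Lim_transform_eventually[OF _ eventually_mono]) simp
  then show ?thesis by (rule LIM_zero_cancel)
qed

section \<open>The expected reciprocal of a sum of independent positive variables\<close>

lemma nn_integral_exp_neg_mult:
  fixes q :: real
  assumes "q > 0"
  shows "(\<integral>\<^sup>+t. ennreal (indicator {0..} t * exp (- (t * q))) \<partial>lborel) = ennreal (1 / q)"
proof -
  have "(\<integral>\<^sup>+t. ennreal (exp (- (t * q))) * indicator {0..} t \<partial>lborel) = ennreal (0 - (- exp (- (0 * q)) / q))"
  proof (rule nn_integral_FTC_atLeast)
    show "((\<lambda>t. - exp (- (t * q)) / q) \<longlongrightarrow> 0) at_top"
      using assms by real_asymp
  qed (use assms in \<open>auto intro!: derivative_eq_intros\<close>)
  then show ?thesis
    by (simp add: ennreal_mult' ennreal_indicator mult.commute)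
qed

text \<open>\<open>D\<close> is the common law of the summands, and \<open>r\<close> will be the
  normalisation. Independence factorises the Laplace transform of the sum into a power of that of
  \<open>D\<close>, and Tonelli exchanges expectation and the integral over
  \<open>t\<close>.\<close>

lemma (in prob_space) expectation_inverse_sum_iid:
  fixes Y :: "'i \<Rightarrow> 'a \<Rightarrow> real" and r :: real
  assumes I: "finite I" "I \<noteq> {}" and r: "r > 0"
    and indep: "indep_vars (\<lambda>_. borel) Y I"
    and ident: "\<And>i. i \<in> I \<Longrightarrow> distr M borel (Y i) = D"
    and pos: "\<And>i. i \<in> I \<Longrightarrow> AE \<omega> in M. Y i \<omega> > 0"
  shows "(\<integral>\<omega>. r / (\<Sum>i\<in>I. Y i \<omega>) \<partial>M) =
    (\<integral>t. indicator {0..} t * (\<integral>y. exp (- (t / r * y)) \<partial>D) ^ card I \<partial>lborel)"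
proof -
  have Y[measurable]: "Y i \<in> borel_measurable M" if "i \<in> I" for i
    using indep that by (simp add: indep_vars_def2)
  define S where "S \<omega> = (\<Sum>i\<in>I. Y i \<omega>)" for \<omega>
  have S[measurable]: "S \<in> borel_measurable M"
    unfolding S_def by measurable
  obtain j where j: "j \<in> I" using I by auto
  have D: "prob_space D"
    using prob_space_distr[OF Y[OF j]] ident[OF j] by simp
  have sets_D[measurable_cong]: "sets D = sets borel"
    using ident[OF j] by (metis sets_distr)
  interpret D: prob_space D by fact
  have "AE \<omega> in M. \<forall>i\<in>I. Y i \<omega> > 0"
    using pos I by (intro AE_finite_allI)
  \<comment> \<open>Here \<open>I\<close> must be nonempty, since an empty sum is 0.\<close>
  then have S_pos: "AE \<omega> in M. S \<omega> > 0"
    by eventually_elim (use I in \<open>auto simp: S_def intro!: sum_pos\<close>)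
  have laplace: "(\<integral>\<^sup>+\<omega>. ennreal (exp (- (t / r * S \<omega>))) \<partial>M) = ennreal ((\<integral>y. exp (- (t / r * y)) \<partial>D) ^ card I)"
    if "t \<ge> 0" for t
  proof -
    have bound: "AE \<omega> in M. norm (exp (- (t / r * Y i \<omega>))) \<le> 1" if "i \<in> I" for i
      using pos[OF that] by eventually_elim (use \<open>t \<ge> 0\<close> r in auto)
    have "(\<integral>\<^sup>+\<omega>. ennreal (exp (- (t / r * S \<omega>))) \<partial>M) = ennreal (\<integral>\<omega>. exp (- (t / r * S \<omega>)) \<partial>M)"
    proof (rule nn_integral_eq_integral)
      have "AE \<omega> in M. norm (exp (- (t / r * S \<omega>))) \<le> 1"
        using S_pos by eventually_elim (use that r in auto)
      then show "integrable M (\<lambda>\<omega>. exp (- (t / r * S \<omega>)))"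
        by (rule integrable_const_bound) measurable
    qed simp
    also have "(\<integral>\<omega>. exp (- (t / r * S \<omega>)) \<partial>M) = (\<integral>\<omega>. (\<Prod>i\<in>I. exp (- (t / r * Y i \<omega>))) \<partial>M)"
      using I by (simp add: S_def sum_distrib_left exp_sum flip: sum_negf)
    also have "\<dots> = (\<Prod>i\<in>I. \<integral>\<omega>. exp (- (t / r * Y i \<omega>)) \<partial>M)"
    proof (rule indep_vars_lebesgue_integral)
      show "indep_vars (\<lambda>_. borel) (\<lambda>i \<omega>. exp (- (t / r * Y i \<omega>))) I"
        by (rule indep_vars_compose2[OF indep]) simp
      show "integrable M (\<lambda>\<omega>. exp (- (t / r * Y i \<omega>)))" if "i \<in> I" for i
        using Y[OF that] by (intro integrable_const_bound[OF bound[OF that]]) auto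
    qed (use I in auto)
    also have "\<dots> = (\<Prod>i\<in>I. \<integral>y. exp (- (t / r * y)) \<partial>D)"
    proof (rule prod.cong[OF refl])
      fix i assume i: "i \<in> I"
      have "(\<integral>y. exp (- (t / r * y)) \<partial>distr M borel (Y i)) = (\<integral>\<omega>. exp (- (t / r * Y i \<omega>)) \<partial>M)"
        using i by (intro integral_distr) auto
      then show "(\<integral>\<omega>. exp (- (t / r * Y i \<omega>)) \<partial>M) = (\<integral>y. exp (- (t / r * y)) \<partial>D)"
        using ident[OF i] by simp
    qed
    finally show ?thesis by simp
  qed
  interpret P: pair_sigma_finite M lborel
    by (intro pair_sigma_finite.intro sigma_finite_measure_axioms sigma_finite_lborel)
  \<comment> \<open>Both ends of the chain pass through \<open>enn2real\<close>, so the equality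
    also covers an infinite value, where both Bochner integrals are 0.\<close>
  have "(\<integral>\<omega>. r / S \<omega> \<partial>M) = enn2real (\<integral>\<^sup>+\<omega>. ennreal (r / S \<omega>) \<partial>M)"
    using S_pos r by (intro integral_eq_nn_integral) auto
  also have "(\<integral>\<^sup>+\<omega>. ennreal (r / S \<omega>) \<partial>M)
      = (\<integral>\<^sup>+\<omega>. (\<integral>\<^sup>+t. ennreal (indicator {0..} t * exp (- (t / r * S \<omega>))) \<partial>lborel) \<partial>M)"
  proof (rule nn_integral_cong_AE)
    show "AE \<omega> in M. ennreal (r / S \<omega>) = (\<integral>\<^sup>+t. ennreal (indicator {0..} t * exp (- (t / r * S \<omega>))) \<partial>lborel)"
      using S_pos
    proof eventually_elim
      case (elim \<omega>)
      then show ?case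
        using nn_integral_exp_neg_mult[of "S \<omega> / r"] r by simp
    qed
  qed
  also have "\<dots> = (\<integral>\<^sup>+t. (\<integral>\<^sup>+\<omega>. ennreal (indicator {0..} t * exp (- (t / r * S \<omega>))) \<partial>M) \<partial>lborel)"
    by (rule P.Fubini'[symmetric]) measurable
  also have "\<dots> = (\<integral>\<^sup>+t. ennreal (indicator {0..} t * (\<integral>y. exp (- (t / r * y)) \<partial>D) ^ card I) \<partial>lborel)"
    using laplace by (intro nn_integral_cong) (auto simp: indicator_def simp del: times_divide_eq_left)
  also have "enn2real \<dots> = (\<integral>t. indicator {0..} t * (\<integral>y. exp (- (t / r * y)) \<partial>D) ^ card I \<partial>lborel)"
    by (rule integral_eq_nn_integral[symmetric])
       (auto intro!: AE_I2 mult_nonneg_nonneg zero_le_power Bochner_Integration.integral_nonneg)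
  finally show ?thesis by (simp add: S_def)
qed

section \<open>Passage to the limit under the integral\<close>

text \<open>Dominated convergence: \<open>bound\<close> supplies one integrable majorant for all
  \<open>n\<close>, and \<open>lim\<close> supplies the pointwise limit through
  \<open>power_tendsto_exp_neg\<close>.\<close>

lemma (in prob_space) expectation_inverse_sum_iid_tendsto:
  fixes Y :: "nat \<Rightarrow> 'a \<Rightarrow> real" and a K k :: real
  assumes indep: "indep_vars (\<lambda>_. borel) Y {1..}"
    and ident: "\<And>i. i \<ge> 1 \<Longrightarrow> distr M borel (Y i) = D"
    and pos: "\<And>i. i \<ge> 1 \<Longrightarrow> AE \<omega> in M. Y i \<omega> > 0"
    and a: "a > 0" and k: "k > 0" and K: "K \<ge> 0"
    and bound: "\<And>s. s \<ge> 0 \<Longrightarrow> (\<integral>y. exp (- (s * y)) \<partial>D) \<le> exp (- k * s powr a)"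
    and lim: "((\<lambda>s. (1 - (\<integral>y. exp (- (s * y)) \<partial>D)) / s powr a) \<longlongrightarrow> K) (at_right 0)"
  shows "(\<lambda>n. \<integral>\<omega>. real n powr (1 / a) / (\<Sum>i=1..n. Y i \<omega>) \<partial>M) \<longlonglongrightarrow>
    (\<integral>t. indicator {0..} t * exp (- (K * t powr a)) \<partial>lborel)"
proof -
  define \<phi> where "\<phi> s = (\<integral>y. exp (- (s * y)) \<partial>D)" for s
  define r where "r n = real n powr (1 / a)" for n
  have Y1: "Y 1 \<in> borel_measurable M"
    using indep by (simp add: indep_vars_def2)
  have D: "prob_space D"
    using prob_space_distr[OF Y1] ident[of 1] by simp
  have sets_D[measurable_cong]: "sets D = sets borel"
    using ident[of 1] by (metis sets_distr order_refl)
  interpret D: prob_space D by fact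
  have [measurable]: "\<phi> \<in> borel_measurable borel"
    unfolding \<phi>_def by measurable
  have \<phi>_nonneg: "0 \<le> \<phi> s" for s
    by (simp add: \<phi>_def)
  have \<phi>_le_1: "\<phi> s \<le> 1" if "s \<ge> 0" for s
    using bound[OF that] k by (simp add: \<phi>_def) (smt (verit) exp_le_one_iff mult_nonneg_nonneg powr_ge_zero)
  have r_pos: "r (Suc n) > 0" for n by (simp add: r_def)
  \<comment> \<open>This identity dictates the normalisation: the factor \<open>1 / real n\<close>
    cancels against the n-th power.\<close>
  have r_powr: "(t / r n) powr a = t powr a / real n" if "t \<ge> 0" for t n
    using that a by (simp add: r_def powr_divide powr_powr)
  \<comment> \<open>The shift to \<open>Suc n\<close> keeps the index set nonempty and
    \<open>r\<close> positive; it is undone at the end.\<close>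
  have eq: "(\<integral>\<omega>. real (Suc n) powr (1 / a) / (\<Sum>i=1..Suc n. Y i \<omega>) \<partial>M) =
      (\<integral>t. indicator {0..} t * \<phi> (t / r (Suc n)) ^ Suc n \<partial>lborel)" for n
    using expectation_inverse_sum_iid[OF _ _ r_pos indep_vars_subset[OF indep] ident pos, of "{1..Suc n}" n]
    by (simp add: \<phi>_def r_def del: sum.cl_ivl_Suc power_Suc)
  have "(\<lambda>n. \<integral>t. indicator {0..} t * \<phi> (t / r (Suc n)) ^ Suc n \<partial>lborel) \<longlonglongrightarrow>
    (\<integral>t. indicator {0..} t * exp (- (K * t powr a)) \<partial>lborel)"
  proof (rule integral_dominated_convergence)
    show "integrable lborel (\<lambda>t. indicator {0..} t * exp (- k * t powr a))"
      using k a by (rule integrable_exp_neg_powr)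
    show "AE t in lborel. norm (indicator {0..} t * \<phi> (t / r (Suc n)) ^ Suc n)
        \<le> indicator {0..} t * exp (- k * t powr a)" for n
    proof (rule AE_I2)
      fix t :: real
      have "\<phi> (t / r (Suc n)) ^ Suc n \<le> exp (- k * t powr a)" if "t \<ge> 0"
      proof -
        have "\<phi> (t / r (Suc n)) ^ Suc n \<le> exp (- k * (t / r (Suc n)) powr a) ^ Suc n"
          using bound[of "t / r (Suc n)"] that r_pos[of n] \<phi>_nonneg
          by (intro power_mono) (auto simp: \<phi>_def)
        also have "\<dots> = exp (real (Suc n) * (- k * (t / r (Suc n)) powr a))"
          by (rule exp_of_nat_mult[symmetric])
        also have "\<dots> = exp (- k * t powr a)"
          unfolding r_powr[OF that] by simp
        finally show ?thesis .
      qed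
      then show "norm (indicator {0..} t * \<phi> (t / r (Suc n)) ^ Suc n)
        \<le> indicator {0..} t * exp (- k * t powr a)"
        using \<phi>_nonneg by (auto simp: indicator_def abs_mult simp del: power_Suc)
    qed
    show "AE t in lborel. (\<lambda>n. indicator {0..} t * \<phi> (t / r (Suc n)) ^ Suc n)
        \<longlonglongrightarrow> indicator {0..} t * exp (- (K * t powr a))"
    proof (rule AE_I2)
      fix t :: real
      consider "t < 0" | "t = 0" | "t > 0" by linarith
      then show "(\<lambda>n. indicator {0..} t * \<phi> (t / r (Suc n)) ^ Suc n)
        \<longlonglongrightarrow> indicator {0..} t * exp (- (K * t powr a))"
      proof cases
        \<comment> \<open>At t = 0 both sides are 1, as \<open>D\<close> has total mass 1 and
          \<open>0 powr a = 0\<close>; \<open>lim\<close> speaks only of positive arguments.\<close>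
        case 2
        then show ?thesis using D.prob_space by (simp add: \<phi>_def)
      next
        case 3
        have "(\<lambda>n. t / r n) \<longlonglongrightarrow> 0"
          unfolding r_def using a 3 by real_asymp
        moreover have "\<forall>\<^sub>F n in sequentially. t / r n > 0"
          using eventually_gt_at_top[of 0] by eventually_elim (use 3 in \<open>simp add: r_def\<close>)
        ultimately have "filterlim (\<lambda>n. t / r n) (at_right 0) sequentially"
          by (rule tendsto_imp_filterlim_at_right)
        from filterlim_compose[OF lim this]
        have "(\<lambda>n. (1 - \<phi> (t / r n)) / (t / r n) powr a * t powr a) \<longlonglongrightarrow> K * t powr a"
          by (intro tendsto_intros) (simp add: \<phi>_def)
        then have "(\<lambda>n. real n * (1 - \<phi> (t / r n))) \<longlonglongrightarrow> K * t powr a"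
        proof (rule Lim_transform_eventually)
          show "\<forall>\<^sub>F n in sequentially. (1 - \<phi> (t / r n)) / (t / r n) powr a * t powr a = real n * (1 - \<phi> (t / r n))"
            using eventually_gt_at_top[of 0] by eventually_elim (use 3 in \<open>simp add: r_powr field_simps\<close>)
        qed
        then have "(\<lambda>n. \<phi> (t / r n) ^ n) \<longlonglongrightarrow> exp (- (K * t powr a))"
          using 3 K by (intro power_tendsto_exp_neg) (auto simp: \<phi>_nonneg intro!: \<phi>_le_1 simp: r_def)
        from LIMSEQ_Suc[OF this] show ?thesis
          using 3 by (simp del: power_Suc)
      qed auto
    qed
  qed measurable
  then show ?thesis
    unfolding eq[symmetric] by (rule LIMSEQ_imp_Suc)
qed

section \<open>Application to the harmonic mean\<close>

theorem theoremG:
  fixes M :: "'a measure" and X :: "nat \<Rightarrow> 'a \<Rightarrow> real"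
    and f :: "real \<Rightarrow> real" and c \<beta> :: real
  assumes "prob_space M"
    and "prob_space.indep_vars M (\<lambda>_. borel) X {1..}"
    and "\<And>i. i \<ge> 1 \<Longrightarrow> AE \<omega> in M. X i \<omega> \<in> {0..1}"
    and "\<And>x. f x \<ge> 0"
    and "\<And>i. i \<ge> 1 \<Longrightarrow> distributed M lborel (X i) (\<lambda>x. ennreal (f x))"
    and "c > 0" and "-1 < \<beta>" and "\<beta> < 0"
    and "((\<lambda>x. f x / (c * x powr \<beta>)) \<longlongrightarrow> 1) (at_right 0)"
  shows "\<exists>C2 :: real.
    (\<lambda>n. \<integral>\<omega>. harmonic_mean (\<lambda>i. X i \<omega>) n / real n powr (1 - 1 / (1 + \<beta>)) \<partial>M)
      \<longlonglongrightarrow> C2"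
proof -
  interpret prob_space M by fact
  note indep = assms(2) and nn = assms(4) and dist = assms(5)
  define a where "a = 1 + \<beta>"
  have a: "0 < a" "a < 1" using assms by (auto simp: a_def)
  have [measurable]: "f \<in> borel_measurable borel"
    using distributed_real_measurable[OF _ dist[of 1]] nn by simp
  have X[measurable]: "X i \<in> borel_measurable M" if "i \<ge> 1" for i
    using indep that by (simp add: indep_vars_def2)
  \<comment> \<open>A law with a density gives no mass to 0, so almost surely \<open>1 / X i\<close>
    is a genuine reciprocal.\<close>
  have X_pos: "AE \<omega> in M. 0 < X i \<omega> \<and> X i \<omega> \<le> 1" if i: "i \<ge> 1" for i
  proof -
    have "AE x in lborel. x \<noteq> (0::real)"
      by (rule AE_lborel_singleton)
    then have "AE x in lborel. 0 < ennreal (f x) \<longrightarrow> x \<noteq> 0"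
      by eventually_elim simp
    then have "AE \<omega> in M. X i \<omega> \<noteq> 0"
      by (subst distributed_AE2[OF dist[OF i]]) auto
    with assms(3)[OF i] show ?thesis
      by eventually_elim auto
  qed
  have supp: "AE x in lborel. x \<le> 0 \<longrightarrow> f x = 0"
  proof -
    have "AE \<omega> in M. 0 < X 1 \<omega>"
      using X_pos[OF order_refl] by eventually_elim auto
    then have "AE x in lborel. 0 < ennreal (f x) \<longrightarrow> 0 < x"
      by (subst (asm) distributed_AE2[OF dist[of 1]]) auto
    then show ?thesis
      by eventually_elim (use nn in \<open>force simp: order_less_le\<close>)
  qed
  have f_int: "integrable lborel f"
    using distributed_integrable[OF dist[of 1], of "\<lambda>_. 1"] nn by simp
  \<comment> \<open>Built from the density alone, so that it is visibly the law of
    \<open>1 / X i\<close> for every i \<ge> 1.\<close>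
  define D where "D = distr (density lborel (\<lambda>x. ennreal (f x))) borel (\<lambda>x. 1 / x)"
  define \<phi> where "\<phi> s = (\<integral>y. exp (- (s * y)) \<partial>D)" for s
  have D_eq: "distr M borel (\<lambda>\<omega>. 1 / X i \<omega>) = D" if i: "i \<ge> 1" for i
  proof -
    have "D = distr (distr M lborel (X i)) borel (\<lambda>x. 1 / x)"
      by (simp add: D_def distributed_distr_eq_density[OF dist[OF i]])
    also have "\<dots> = distr M borel (\<lambda>\<omega>. 1 / X i \<omega>)"
      using X[OF i] by (subst distr_distr) (auto simp: o_def)
    finally show ?thesis ..
  qed
  have \<phi>_X: "\<phi> s = (\<integral>\<omega>. exp (- s / X 1 \<omega>) \<partial>M)" for s
    unfolding \<phi>_def D_eq[OF order_refl, symmetric] by (subst integral_distr) auto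
  have exp_int: "integrable M (\<lambda>\<omega>. exp (- s / X 1 \<omega>))" if "s \<ge> 0" for s
  proof (rule integrable_const_bound)
    show "AE \<omega> in M. norm (exp (- s / X 1 \<omega>)) \<le> 1"
      using X_pos[OF order_refl] by eventually_elim (use that in auto)
  qed simp
  have deficit: "1 - \<phi> s = (\<integral>x. f x * (1 - exp (- s / x)) \<partial>lborel)" if "s \<ge> 0" for s
    using distributed_integral[OF dist[of 1], of "\<lambda>x. 1 - exp (- s / x)"] nn prob_space exp_int[OF that]
    by (simp add: \<phi>_X)
  define K where "K = (\<integral>u. indicator {0<..} u * (c * (u powr \<beta> * (1 - exp (- 1 / u)))) \<partial>lborel)"
  have K: "K > 0"
    unfolding K_def using assms by (intro integral_exp_deficit_pos)
  have lim: "((\<lambda>s. (1 - \<phi> s) / s powr a) \<longlongrightarrow> K) (at_right 0)"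
  proof (rule Lim_transform_eventually)
    show "((\<lambda>s. (\<integral>x. f x * (1 - exp (- s / x)) \<partial>lborel) / s powr (1 + \<beta>)) \<longlongrightarrow> K) (at_right 0)"
      unfolding K_def by (rule laplace_deficit_asymp) (use f_int supp assms in auto)
    show "\<forall>\<^sub>F s in at_right 0. (\<integral>x. f x * (1 - exp (- s / x)) \<partial>lborel) / s powr (1 + \<beta>) = (1 - \<phi> s) / s powr a"
      using eventually_at_right_less[of 0] by eventually_elim (simp add: deficit a_def)
  qed
  have "\<forall>\<^sub>F s in at_right 0. (1 - \<phi> s) / s powr a > K / 2"
    using lim K by (intro order_tendstoD) auto
  then obtain s0 where s0: "s0 > 0" "\<And>s. 0 < s \<Longrightarrow> s < s0 \<Longrightarrow> (1 - \<phi> s) / s powr a > K / 2"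
    by (auto simp: eventually_at_right[OF zero_less_one])
  \<comment> \<open>The first entry serves \<open>s < s0\<close>, where \<open>1 - \<phi> s\<close>
    is at least \<open>K / 2 * s powr a\<close>. The second serves \<open>s \<ge> s0\<close>: as a <
    1, it gives \<open>k * s powr a \<le> s\<close>.\<close>
  define k where "k = min (K / 2) (s0 powr (1 - a))"
  have k: "k > 0" using K s0 by (simp add: k_def)
  have bound: "\<phi> s \<le> exp (- k * s powr a)" if "s \<ge> 0" for s
  proof -
    consider "s = 0" | "0 < s" "s < s0" | "s0 \<le> s" using \<open>s \<ge> 0\<close> by linarith
    then show ?thesis
    proof cases
      case 1
      then show ?thesis using prob_space by (simp add: \<phi>_X)
    next
      case 2
      then have "K / 2 * s powr a \<le> 1 - \<phi> s"
        using s0(2)[of s] by (simp add: field_simps)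
      moreover have "k * s powr a \<le> K / 2 * s powr a"
        by (intro mult_right_mono) (auto simp: k_def)
      ultimately have "\<phi> s \<le> 1 + - k * s powr a" by simp
      also have "\<dots> \<le> exp (- k * s powr a)" by (rule exp_ge_add_one_self)
      finally show ?thesis .
    next
      case 3
      \<comment> \<open>Since \<open>X 1\<close> is at most 1 almost surely, \<open>s / X 1\<close>
        is at least \<open>s\<close>.\<close>
      have "\<phi> s \<le> (\<integral>\<omega>. exp (- s) \<partial>M)"
        unfolding \<phi>_X
      proof (rule integral_mono_AE)
        show "AE \<omega> in M. exp (- s / X 1 \<omega>) \<le> exp (- s)"
          using X_pos[OF order_refl]
        proof eventually_elim
          case (elim \<omega>)
          then have "s * X 1 \<omega> \<le> s * 1"
            using \<open>s \<ge> 0\<close> by (intro mult_left_mono) auto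
          then show ?case using elim by (simp add: field_simps)
        qed
      qed (use exp_int[OF \<open>s \<ge> 0\<close>] in auto)
      also have "\<dots> = exp (- s)" using prob_space by simp
      also have "k * s powr a \<le> s powr (1 - a) * s powr a"
        using 3 s0 a by (intro mult_right_mono) (auto simp: k_def min.coboundedI2 powr_mono2)
      then have "exp (- s) \<le> exp (- k * s powr a)"
        using \<open>s \<ge> 0\<close> by (simp flip: powr_add)
      finally show ?thesis .
    qed
  qed
  have "(\<lambda>n. \<integral>\<omega>. real n powr (1 / a) / (\<Sum>i=1..n. 1 / X i \<omega>) \<partial>M) \<longlonglongrightarrow>
    (\<integral>t. indicator {0..} t * exp (- (K * t powr a)) \<partial>lborel)"
  proof (rule expectation_inverse_sum_iid_tendsto[where D = D and k = k])
    show "indep_vars (\<lambda>_. borel) (\<lambda>i \<omega>. 1 / X i \<omega>) {1..}"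
      by (rule indep_vars_compose2[OF indep]) simp
    show "AE \<omega> in M. 1 / X i \<omega> > 0" if "i \<ge> 1" for i
      using X_pos[OF that] by eventually_elim simp
  qed (use D_eq a k K bound lim in \<open>auto simp: \<phi>_def\<close>)
  \<comment> \<open>The factor n in the harmonic mean combines with the normalisation to the power
    1/a; for n = 0 both sides are 0.\<close>
  moreover have "harmonic_mean (\<lambda>i. X i \<omega>) n / real n powr (1 - 1 / (1 + \<beta>))
      = real n powr (1 / a) / (\<Sum>i=1..n. 1 / X i \<omega>)" for n \<omega>
    by (cases "n = 0") (auto simp: harmonic_mean_def reciprocal_mean_def a_def powr_diff)
  ultimately show ?thesis by auto
qed

end
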